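(* Let $d\geq 3$ be an integer, let $m_d=\sqrt{2\pi d}+1$, and let $$C_d^*=\frac{4(m_d+1)(d-1)\kappa_{d-1}}{d\kappa_{d}}.$$ Let $\alpha:\mathbb{N}\to(0,1]$ be a function with $\lim_{n\to\infty}\alpha(n)=0$, and let $k:\mathbb{N}\to\mathbb{N}$ be a function satisfying $$\limsup_{n\to\infty}\ \alpha(n)^{-(d-1)}\left(\frac{e\,C_d^*\,n\,\alpha(n)}{k(n)}\right)^{k(n)}=\beta<1 .$$ Then, for all sufficiently large $n$, there exists an arrangement of $n$ zones of spherical half-width $m_d\,\alpha(n)$ on $S^{d-1}$ such that no point of $S^{d-1}$ belongs to more than $k(n)$ of the zones.
   Context: $\mathbb{N}$ is the set of positive integers. $\kappa_j$ denotes the volume of the $j$-dimensional Euclidean unit ball. $S^{d-1}$ is the unit sphere centred at the origin of $\mathbb{R}^d$. A great sphere of $S^{d-1}$ is the intersection of $S^{d-1}$ with a hyperplane through the origin. A (spherical) zone of half-width $t$ is the set of points of $S^{d-1}$ at spherical (geodesic) distance at most $t$ from a great sphere; for $0<t\leq\pi/2$ it equals $\{x\in S^{d-1}:|\langle x,u\rangle|\leq\sin t\}$ for a unit vector $u$. *)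

theory Defs
  imports "HOL-Analysis.Analysis"
begin

definition great_sphere :: "'a::euclidean_space set \<Rightarrow> bool" where
  "great_sphere G \<longleftrightarrow> (\<exists>u. u \<noteq> 0 \<and> G = sphere 0 1 \<inter> {x. u \<bullet> x = 0})"

text \<open>Geodesic distance on the unit sphere; only meaningful for unit vectors.\<close>

definition spherical_dist :: "'a::euclidean_space \<Rightarrow> 'a \<Rightarrow> real" where
  "spherical_dist x y = arccos (x \<bullet> y)"

text \<open>The infimum below is over a nonempty set as soon as the dimension is at least 2.\<close>

definition spherical_zone :: "real \<Rightarrow> 'a::euclidean_space set \<Rightarrow> bool" where
  "spherical_zone t Z \<longleftrightarrow>
     (\<exists>G. great_sphere G \<and> Z = {x \<in> sphere 0 1. (INF y\<in>G. spherical_dist x y) \<le> t})"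

definition m_const :: "nat \<Rightarrow> real" where
  "m_const d = sqrt (2 * pi * real d) + 1"

definition C_star :: "nat \<Rightarrow> real" where
  "C_star d = 4 * (m_const d + 1) * (real d - 1) * unit_ball_vol (real d - 1)
                / (real d * unit_ball_vol (real d))"

end

(* If norm u < 1, the zone with normal u lies in a slab normal to u; a uniformly random u in the unit ball
   satisfies |<q, u>| < s, for a fixed unit vector q, with probability p at most
   2 s kappa_{d-1} / kappa_d.  For s = (m_d + 1) alpha this is at most 3/4 of C_d^* alpha, because
   d / (2 (d - 1)) <= 3/4 when d >= 3.  If more than k zones of half-width m_d alpha meet in a point,
   then more than k of the normals satisfy this for a nearby point q of an alpha-net, and a volume argument
   provides a net of O(alpha^{-(d-1)}) points.  The Chernoff bound (e n p / (k + 1))^{k+1} and the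
   union bound over the net suffice: the factor (3/4)^{k+1} absorbs the constant of the net when k is
   large, and when k is bounded the exponent k + 1 in place of k does. *)

theory Submission
  imports Defs "HOL-Probability.Probability_Measure"
begin

section \<open>Volume of a slab in the unit ball\<close>

text \<open>The library's \<open>measure_orthogonal_image\<close> needs a well-ordered index type. Instead we
  exhaust the open set by disjoint balls (Vitali), which orthogonal maps send to congruent balls.\<close>

lemma emeasure_orthogonal_image_open_le:
  fixes f :: "'a::euclidean_space \<Rightarrow> 'a"
  assumes f: "orthogonal_transformation f" and S: "open S"
  shows "emeasure lborel (f ` S) \<le> emeasure lborel S"
proof -
  define K where "K = {(a, r). 0 < r \<and> ball a r \<subseteq> S}"
  have "\<exists>i. i \<in> K \<and> x \<in> ball (fst i) (snd i) \<and> snd i < d" if xd: "x \<in> S" "d > 0" for x d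
  proof -
    obtain e where "e > 0" "ball x e \<subseteq> S"
      using S xd(1) open_contains_ball by blast
    then show ?thesis
      using xd(2) by (intro exI[of _ "(x, min e (d/2))"]) (auto simp: K_def)
  qed
  then obtain C where C: "countable C" "C \<subseteq> K"
    and disj: "pairwise (\<lambda>i j. disjnt (ball (fst i) (snd i)) (ball (fst j) (snd j))) C"
    and neg: "negligible (S - (\<Union>i\<in>C. ball (fst i) (snd i)))"
    using Vitali_covering_theorem_balls[of S K fst snd] by blast
  let ?N = "S - (\<Union>i\<in>C. ball (fst i) (snd i))"
  have lin: "linear f"
    using f by (rule orthogonal_transformation_linear)
  have negf: "negligible (f ` ?N)"
    by (rule negligible_differentiable_image_negligible[OF order_refl neg])
      (use lin in \<open>simp add: linear_imp_differentiable_on\<close>)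
  then have N0: "f ` ?N \<in> null_sets lebesgue"
    by (simp add: negligible_iff_null_sets)
  have im: "f ` ball a r = ball (f a) r" for a r
    using f by (rule image_orthogonal_transformation_ball)
  have fS: "f ` S \<subseteq> f ` ?N \<union> (\<Union>i\<in>C. ball (f (fst i)) (snd i))"
    using im by blast
  have UN: "(\<Union>i\<in>C. ball (f (fst i)) (snd i)) \<in> sets lborel"
    by (simp add: borel_open open_UN)
  have opf: "open (f ` S)"
    using open_surjective_linear_image[OF S lin orthogonal_transformation_surj[OF f]] .
  \<comment> \<open>The uncovered part enters only through \<open>null_sets lebesgue\<close>, so the
    estimate passes to the completed measure and returns once that part is discarded.\<close>
  have "emeasure lborel (f ` S) = emeasure lebesgue (f ` S)"
    using opf by simp
  also have "\<dots> \<le> emeasure lebesgue (f ` ?N \<union> (\<Union>i\<in>C. ball (f (fst i)) (snd i)))"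
    using N0 UN by (intro emeasure_mono[OF fS]) auto
  also have "\<dots> = emeasure lebesgue (\<Union>i\<in>C. ball (f (fst i)) (snd i))"
    using N0 UN by (subst Un_commute, intro emeasure_Un_null_set) auto
  also have "\<dots> = emeasure lborel (\<Union>i\<in>C. ball (f (fst i)) (snd i))"
    using UN by simp
  also have "\<dots> = (\<integral>\<^sup>+i. emeasure lborel (ball (f (fst i)) (snd i)) \<partial>count_space C)"
  proof (intro emeasure_UN_countable C)
    have "f ` X \<inter> f ` Y = {}" if "X \<inter> Y = {}" for X Y
      using that image_Int[OF orthogonal_transformation_inj[OF f]] by (metis image_empty)
    then show "disjoint_family_on (\<lambda>i. ball (f (fst i)) (snd i)) C"
      using disj unfolding im[symmetric] by (auto simp: disjoint_family_on_def pairwise_def disjnt_def)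
  qed auto
  also have "\<dots> = (\<integral>\<^sup>+i. emeasure lborel (ball (fst i) (snd i)) \<partial>count_space C)"
    using C(2) by (intro nn_integral_cong) (auto simp: emeasure_ball K_def)
  also have "\<dots> = emeasure lborel (\<Union>i\<in>C. ball (fst i) (snd i))"
    using C disj by (intro emeasure_UN_countable[symmetric])
      (auto simp: disjoint_family_on_def pairwise_def disjnt_def)
  also have "\<dots> \<le> emeasure lborel S"
    using C(2) S by (intro emeasure_mono) (fastforce simp: K_def)+
  finally show ?thesis .
qed

text \<open>Fubini along \<open>b\<close>: the coordinate \<open>y\<close> ranges over an interval
  of length \<open>2 * s\<close>, and deleting it from a point of the unit ball leaves a point of
  the unit ball one dimension lower.\<close>

lemma emeasure_coordinate_slab_le:
  fixes b :: "'a::euclidean_space"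
  assumes b: "b \<in> Basis" and s: "s \<ge> 0"
  shows "emeasure lborel (ball 0 1 \<inter> {x. \<bar>b \<bullet> x\<bar> < s})
    \<le> ennreal (2 * s * unit_ball_vol (real DIM('a) - 1))"
proof -
  interpret product_sigma_finite "\<lambda>_::'a. lborel :: real measure"
    by standard
  let ?B = "Basis - {b}"
  let ?P = "Pi\<^sub>M ?B (\<lambda>_. lborel) :: ('a \<Rightarrow> real) measure"
  let ?T = "{f. sqrt (\<Sum>i\<in>?B. (f i)\<^sup>2) \<le> 1} \<inter> space ?P"
  have ins: "insert b ?B = (Basis :: 'a set)"
    using b by auto
  have T[measurable]: "?T \<in> sets ?P"
    by measurable
  have [measurable]: "(\<lambda>f. \<Sum>b\<in>Basis. f b *\<^sub>R b :: 'a) \<in> borel_measurable (Pi\<^sub>M Basis (\<lambda>_. lborel))"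
    by measurable
  let ?S = "ball 0 1 \<inter> {x::'a. \<bar>b \<bullet> x\<bar> < s}"
  have S[measurable]: "?S \<in> sets borel"
    by (intro borel_open open_Int open_Collect_less continuous_intros) auto
  have "emeasure lborel ?S = (\<integral>\<^sup>+x. indicator ?S x \<partial>distr (Pi\<^sub>M Basis (\<lambda>_. lborel)) borel (\<lambda>f. \<Sum>b\<in>Basis. f b *\<^sub>R b))"
    using S by (simp add: lborel_eq[symmetric])
  also have "\<dots> = (\<integral>\<^sup>+f. indicator ?S (\<Sum>b\<in>Basis. f b *\<^sub>R b) \<partial>Pi\<^sub>M (insert b ?B) (\<lambda>_. lborel))"
    unfolding ins by (subst nn_integral_distr) auto
  also have "\<dots> = (\<integral>\<^sup>+y. \<integral>\<^sup>+f. indicator ?S (\<Sum>c\<in>Basis. (f(b := y)) c *\<^sub>R c) \<partial>?P \<partial>lborel)"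
    using S by (subst product_nn_integral_insert_rev) (auto simp: insert_absorb[OF b])
  also have "\<dots> \<le> (\<integral>\<^sup>+y. \<integral>\<^sup>+f. indicator {-s..s} y * indicator ?T f \<partial>?P \<partial>lborel)"
  proof (intro nn_integral_mono)
    fix y :: real and f assume f: "f \<in> space ?P"
    define x where "x = (\<Sum>c\<in>Basis. (f(b := y)) c *\<^sub>R c :: 'a)"
    have xc: "x \<bullet> c = (f(b := y)) c" if "c \<in> Basis" for c
      using that unfolding x_def by (rule inner_sum_left_Basis)
    have "y \<in> {-s..s} \<and> f \<in> ?T" if "x \<in> ?S"
    proof
      show "y \<in> {-s..s}"
        using that xc[OF b] by (auto simp: inner_commute)
      have "(\<Sum>i\<in>?B. (f i)\<^sup>2) = (\<Sum>i\<in>?B. (x \<bullet> i)\<^sup>2)"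
        by (intro sum.cong) (auto simp: xc)
      also have "\<dots> \<le> (\<Sum>i\<in>Basis. (x \<bullet> i)\<^sup>2)"
        by (intro sum_mono2) auto
      also have "\<dots> = (norm x)\<^sup>2"
        unfolding power2_norm_eq_inner euclidean_inner[of x x] by (simp add: power2_eq_square)
      also have "\<dots> \<le> 1"
        using that by (simp add: power_le_one)
      finally show "f \<in> ?T"
        using f by simp
    qed
    then show "(indicator ?S x :: ennreal) \<le> indicator {-s..s} y * indicator ?T f"
      by (auto simp: indicator_def)
  qed
  also have "\<dots> = (\<integral>\<^sup>+y. indicator {-s..s} y * emeasure ?P ?T \<partial>lborel)"
    by (simp add: nn_integral_cmult)
  also have "\<dots> = emeasure lborel {-s..s} * emeasure ?P ?T"
    by (simp add: nn_integral_multc)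
  \<comment> \<open>\<open>emeasure_cball_aux\<close> measures the ball in the coordinates indexed
    by \<open>?B\<close>, so no type of dimension one lower has to be introduced.\<close>
  also have "\<dots> = ennreal (2 * s) * ennreal (unit_ball_vol (real (card ?B)))"
    using s by (subst emeasure_cball_aux) auto
  also have "real (card ?B) = real DIM('a) - 1"
    using b by (simp add: of_nat_diff DIM_positive Suc_le_eq)
  also have "ennreal (2 * s) * ennreal (unit_ball_vol (real DIM('a) - 1)) = 
      ennreal (2 * s * unit_ball_vol (real DIM('a) - 1))"
    using s by (simp add: ennreal_mult DIM_positive Suc_le_eq)
  finally show ?thesis .
qed

text \<open>A rotation taking a basis vector to \<open>q\<close> carries the coordinate slab onto
  this one.\<close>

lemma emeasure_slab_le:
  fixes q :: "real ^ 'n"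
  assumes q: "norm q = 1" and s: "s \<ge> 0"
  shows "emeasure lborel (ball 0 1 \<inter> {x. \<bar>q \<bullet> x\<bar> < s})
    \<le> ennreal (2 * s * unit_ball_vol (real CARD('n) - 1))"
proof -
  obtain b :: "real ^ 'n" where b: "b \<in> Basis"
    using nonempty_Basis by blast
  obtain f where f: "orthogonal_transformation f" "f b = q"
    using orthogonal_transformation_exists_1[of b q] q b by auto
  let ?S = "\<lambda>q. ball 0 1 \<inter> {x. \<bar>q \<bullet> x\<bar> < s}"
  have "?S q \<subseteq> f ` ?S b"
  proof
    fix x assume x: "x \<in> ?S q"
    obtain z where z: "x = f z"
      using orthogonal_transformation_surj[OF f(1)] by (metis surjD)
    have "norm z = norm x"
      by (simp add: z orthogonal_transformation_norm[OF f(1)])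
    moreover have "b \<bullet> z = q \<bullet> x"
      using f unfolding z orthogonal_transformation_def by metis
    ultimately show "x \<in> f ` ?S b"
      using x z by auto
  qed
  moreover have S: "open (?S b)"
    by (intro open_Int open_Collect_less continuous_intros) auto
  moreover have "open (f ` ?S b)"
    using open_surjective_linear_image[OF S orthogonal_transformation_linear orthogonal_transformation_surj] f
    by blast
  ultimately have "emeasure lborel (?S q) \<le> emeasure lborel (?S b)"
    by (intro order_trans[OF _ emeasure_orthogonal_image_open_le[OF f(1) S]] emeasure_mono) auto
  also have "\<dots> \<le> ennreal (2 * s * unit_ball_vol (real CARD('n) - 1))"
    using emeasure_coordinate_slab_le[OF b s] by simp
  finally show ?thesis .
qed

section \<open>Nets on the sphere\<close>

text \<open>Factoring the difference of powers exposes the factor \<open>2 * h\<close>: a thin shell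
  has volume linear in its thickness. This factor lowers the exponent of the net size from the
  dimension to one less.\<close>

lemma power_annulus_le:
  fixes h :: real
  assumes "0 \<le> h" "h \<le> 1"
  shows "(1 + h) ^ d - (1 - h) ^ d \<le> 2 * h * (real d * 2 ^ (d - 1))"
proof -
  have "(1 + h) ^ d - (1 - h) ^ d = 2 * h * (\<Sum>i<d. (1 - h) ^ (d - Suc i) * (1 + h) ^ i)"
    by (subst power_diff_sumr2) simp
  also have "(\<Sum>i<d. (1 - h) ^ (d - Suc i) * (1 + h) ^ i) \<le> (\<Sum>i<d. 2 ^ (d - 1))"
  proof (intro sum_mono)
    fix i assume "i \<in> {..<d}"
    have "(1 - h) ^ (d - Suc i) * (1 + h) ^ i \<le> 1 * 2 ^ i"
      using assms by (intro mult_mono power_mono power_le_one) auto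
    also have "\<dots> \<le> 2 ^ (d - 1)"
      using \<open>i \<in> {..<d}\<close> by (auto intro!: power_increasing)
    finally show "(1 - h) ^ (d - Suc i) * (1 + h) ^ i \<le> 2 ^ (d - 1)" .
  qed
  finally show ?thesis
    using assms by (simp add: mult_left_mono)
qed

text \<open>Volume packing: balls of radius \<open>h\<close>, half the separation, about the points
  of \<open>Q\<close> are disjoint and lie in the shell between the radii \<open>1 - h\<close> and
  \<open>1 + h\<close>.\<close>

lemma card_separated_sphere_le:
  fixes Q :: "'a::euclidean_space set"
  assumes Q: "finite Q" "Q \<subseteq> sphere 0 1" and sep: "pairwise (\<lambda>x y. \<delta> < dist x y) Q"
    and \<delta>: "0 < \<delta>" "\<delta> \<le> 1"
  shows "real (card Q) * \<delta> ^ (DIM('a) - 1) \<le> real DIM('a) * 4 ^ DIM('a)"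
proof -
  define h where "h = \<delta> / 2"
  let ?d = "DIM('a)" let ?\<kappa> = "unit_ball_vol (real DIM('a))"
  have h: "0 < h" "h \<le> 1"
    using \<delta> by (auto simp: h_def)
  have disj: "disjoint_family_on (\<lambda>q. ball q h) Q"
    unfolding disjoint_family_on_def
  proof (intro ballI impI)
    fix x y assume xy: "x \<in> Q" "y \<in> Q" "x \<noteq> y"
    then have "2 * h < dist x y"
      using sep by (auto simp: pairwise_def h_def)
    then show "ball x h \<inter> ball y h = {}"
      by (metis (no_types) disjoint_ballI less_le mult_2)
  qed
  have sub: "(\<Union>q\<in>Q. ball q h) \<union> ball 0 (1 - h) \<subseteq> ball 0 (1 + h)"
  proof -
    have "norm x < 1 + h" if "q \<in> Q" "x \<in> ball q h" for q x
    proof -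
      have "norm x \<le> norm q + dist q x"
        by (metis add.commute dist_norm norm_minus_commute norm_triangle_sub)
      then show ?thesis
        using that Q by auto
    qed
    then show ?thesis
      using h by auto
  qed
  have bdd: "bounded (\<Union>q\<in>Q. ball q h)"
    using Q by (intro bounded_UN) auto
  have dis2: "(\<Union>q\<in>Q. ball q h) \<inter> ball 0 (1 - h) = {}"
  proof -
    have "\<not> norm x < 1 - h" if "q \<in> Q" "x \<in> ball q h" for q x
    proof -
      have "norm q \<le> norm x + dist q x"
        by (metis dist_norm norm_triangle_sub)
      then show ?thesis
        using that Q by auto
    qed
    then show ?thesis
      by auto
  qed
  have "real (card Q) * (?\<kappa> * h ^ ?d) + ?\<kappa> * (1 - h) ^ ?d
      = (\<Sum>q\<in>Q. measure lborel (ball q h)) + measure lborel (ball (0::'a) (1 - h))"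
    using h by (simp add: content_ball)
  also have "(\<Sum>q\<in>Q. measure lborel (ball q h)) = measure lborel (\<Union>q\<in>Q. ball q h)"
    using Q disj by (intro measure_finite_Union[symmetric]) (auto simp: emeasure_ball h less_imp_le)
  also have "\<dots> + measure lborel (ball (0::'a) (1 - h)) = measure lborel ((\<Union>q\<in>Q. ball q h) \<union> ball 0 (1 - h))"
    using dis2 emeasure_bounded_finite[OF bdd] emeasure_lborel_ball_finite[of "0::'a" "1 - h"] by (intro measure_Union[symmetric])
       (auto intro!: borel_open)
  also have "\<dots> \<le> measure lborel (ball (0::'a) (1 + h))"
    by (intro measure_mono_fmeasurable sub fmeasurableI emeasure_bounded_finite) (auto intro!: borel_open)
  also have "\<dots> = ?\<kappa> * (1 + h) ^ ?d"
    using h by (simp add: content_ball)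
  finally have "?\<kappa> * (real (card Q) * h ^ ?d) \<le> ?\<kappa> * ((1 + h) ^ ?d - (1 - h) ^ ?d)"
    by (simp add: algebra_simps)
  then have "real (card Q) * h ^ ?d \<le> (1 + h) ^ ?d - (1 - h) ^ ?d"
    by simp
  also have "\<dots> \<le> 2 * h * (real ?d * 2 ^ (?d - 1))"
    using h by (intro power_annulus_le) auto
  finally have "h * (real (card Q) * h ^ (?d - 1)) \<le> h * (2 * (real ?d * 2 ^ (?d - 1)))"
    by (simp add: power_eq_if[of h ?d] mult_ac)
  then have "real (card Q) * h ^ (?d - 1) \<le> real ?d * 2 ^ ?d"
    using h by (simp add: power_eq_if[of 2 ?d])
  \<comment> \<open>Back from \<open>h\<close> to \<open>\<delta>\<close>: the factor on the right
    is rounded up to \<open>2 ^ ?d\<close>, which gives the constant \<open>4 ^ ?d\<close>.\<close>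
  then have "2 ^ (?d - 1) * (real (card Q) * h ^ (?d - 1)) \<le> 2 ^ ?d * (real ?d * 2 ^ ?d)"
    by (intro mult_mono[OF power_increasing]) (use h in auto)
  moreover have "\<delta> ^ (?d - 1) = 2 ^ (?d - 1) * h ^ (?d - 1)"
    by (simp add: h_def power_divide)
  moreover have "(4::real) ^ ?d = 2 ^ ?d * 2 ^ ?d"
    by (simp flip: power_mult_distrib)
  ultimately show ?thesis
    by (simp add: mult_ac)
qed

text \<open>A separated set of greatest cardinality is a net, since a point far from all of it could
  be added. The packing bound guarantees that a greatest cardinality exists.\<close>

lemma sphere_net:
  assumes \<delta>: "0 < \<delta>" "\<delta> \<le> 1"
  obtains Q :: "'a::euclidean_space set" where "finite Q" "Q \<subseteq> sphere 0 1"
    "\<And>p. p \<in> sphere 0 1 \<Longrightarrow> \<exists>q\<in>Q. dist p q \<le> \<delta>"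
    "real (card Q) * \<delta> ^ (DIM('a) - 1) \<le> real DIM('a) * 4 ^ DIM('a)"
proof -
  define P where "P Q \<longleftrightarrow> finite Q \<and> Q \<subseteq> sphere 0 1 \<and> pairwise (\<lambda>x y. \<delta> < dist x y) Q" for Q :: "'a set"
  define B where "B = real DIM('a) * 4 ^ DIM('a)"
  have PB: "real (card Q) * \<delta> ^ (DIM('a) - 1) \<le> B" if "P Q" for Q
    using card_separated_sphere_le[of Q \<delta>] that \<delta> by (auto simp: P_def B_def)
  then have "real (card Q) \<le> B / \<delta> ^ (DIM('a) - 1)" if "P Q" for Q
    using \<delta> that by (simp add: field_simps)
  then have "\<forall>Q. P Q \<longrightarrow> card Q \<le> nat \<lceil>B / \<delta> ^ (DIM('a) - 1)\<rceil>"
    by (meson of_nat_le_iff order_trans real_nat_ceiling_ge)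
  moreover have "P {}"
    by (simp add: P_def)
  ultimately obtain Q where Q: "P Q" and max: "\<And>R. P R \<Longrightarrow> card R \<le> card Q"
    using ex_has_greatest_nat[of P "{}" card "Suc (nat \<lceil>B / \<delta> ^ (DIM('a) - 1)\<rceil>)"] by (auto simp: less_Suc_eq_le)
  show thesis
  proof
    show "\<exists>q\<in>Q. dist p q \<le> \<delta>" if "p \<in> sphere 0 1" for p
    proof (rule ccontr)
      assume far: "\<not> (\<exists>q\<in>Q. dist p q \<le> \<delta>)"
      then have "p \<notin> Q"
        using \<delta> by auto
      moreover have "P (insert p Q)"
        using Q far that by (auto simp: P_def pairwise_insert dist_commute not_le)
      ultimately show False
        using max[of "insert p Q"] Q by (simp add: P_def)
    qed
  qed (use Q PB in \<open>auto simp: P_def B_def\<close>)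
qed

section \<open>Derandomized choice of points\<close>

text \<open>Conditional expectations: the points are chosen one at a time so that the exponential
  potential on the left never exceeds its mean. The almost sure conditions keep the chosen points
  in \<open>G\<close> and their \<open>h\<close>-values distinct.\<close>

lemma (in prob_space) low_multiplicity_selection:
  fixes h :: "'a \<Rightarrow> 'b" and A :: "'q \<Rightarrow> 'a set"
  assumes Q: "finite Q" and A: "\<And>q. q \<in> Q \<Longrightarrow> A q \<in> events" "\<And>q. q \<in> Q \<Longrightarrow> prob (A q) \<le> p"
    and t: "1 \<le> t" and G: "AE x in M. G x" and h: "\<And>c. AE x in M. h x \<noteq> c"
  shows "\<exists>U. finite U \<and> card U = n \<and> inj_on h U \<and> (\<forall>u\<in>U. G u) \<and>
    (\<Sum>q\<in>Q. t ^ card (U \<inter> A q)) \<le> real (card Q) * (1 + p * (t - 1)) ^ n"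
proof (induction n)
  case 0
  show ?case
    by (intro exI[of _ "{}"]) auto
next
  case (Suc n)
  then obtain U where U: "finite U" "card U = n" "inj_on h U" "\<And>u. u \<in> U \<Longrightarrow> G u"
    and pot: "(\<Sum>q\<in>Q. t ^ card (U \<inter> A q)) \<le> real (card Q) * (1 + p * (t - 1)) ^ n"
    by blast
  define w where "w q = t ^ card (U \<inter> A q)" for q
  \<comment> \<open>\<open>g x\<close> is the potential after adding \<open>x\<close>: a new point
    multiplies the summand of \<open>q\<close> by \<open>t\<close> exactly when it lies in
    \<open>A q\<close>.\<close>
  define g where "g x = (\<Sum>q\<in>Q. w q * (1 + (t - 1) * indicator (A q) x))" for x
  have w: "w q \<ge> 0" for q
    using t by (simp add: w_def)
  have intA: "integrable M (indicator (A q) :: 'a \<Rightarrow> real)" if "q \<in> Q" for q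
    using A(1)[OF that] by (simp add: integrable_indicator_iff less_top[symmetric])
  have g_int: "integrable M g"
    unfolding g_def using intA by (intro Bochner_Integration.integrable_sum) auto
  have "expectation g = (\<Sum>q\<in>Q. w q * (1 + (t - 1) * prob (A q)))"
    unfolding g_def using intA A(1) by (simp add: prob_space)
  also have "\<dots> \<le> (\<Sum>q\<in>Q. w q * (1 + p * (t - 1)))"
    using A(2) t w by (intro sum_mono mult_left_mono) (auto simp: mult.commute[of p] mult_left_mono)
  finally have Eg: "expectation g \<le> (\<Sum>q\<in>Q. w q) * (1 + p * (t - 1))"
    by (simp add: sum_distrib_right)
  \<comment> \<open>Otherwise \<open>g\<close> would exceed its own mean almost everywhere.\<close>
  have "\<exists>x. G x \<and> h x \<notin> h ` U \<and> g x \<le> expectation g"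
  proof (rule ccontr)
    assume none: "\<not> ?thesis"
    have "AE x in M. \<forall>c\<in>h ` U. h x \<noteq> c"
      using U(1) h by (intro AE_finite_allI) auto
    then have "AE x in M. expectation g < g x"
      using G by eventually_elim (use none in \<open>force simp: not_le\<close>)
    then have "expectation (\<lambda>x. expectation g) < expectation g"
      using g_int by (intro integral_less_AE_space) (auto simp: emeasure_space_1)
    then show False
      by (simp add: prob_space)
  qed
  then obtain x where x: "G x" "h x \<notin> h ` U" "g x \<le> expectation g"
    by blast
  have xU: "x \<notin> U"
    using x(2) by blast
  have "t ^ card (insert x U \<inter> A q) = w q * (1 + (t - 1) * indicator (A q) x)" for q
    using U(1) xU by (cases "x \<in> A q") (auto simp: w_def Int_insert_left)
  then have "(\<Sum>q\<in>Q. t ^ card (insert x U \<inter> A q)) = g x"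
    by (simp add: g_def)
  also have "\<dots> \<le> (\<Sum>q\<in>Q. w q) * (1 + p * (t - 1))"
    using x(3) Eg by linarith
  also have "\<dots> \<le> real (card Q) * (1 + p * (t - 1)) ^ n * (1 + p * (t - 1))"
  \<comment> \<open>Only an element of \<open>Q\<close> shows \<open>p\<close> to be nonnegative;
    for empty \<open>Q\<close> both sides vanish.\<close>
  proof (cases "Q = {}")
    case False
    then obtain q where "q \<in> Q"
      by blast
    then have "0 \<le> p"
      using A(2) measure_nonneg order_trans by blast
    then show ?thesis
      using pot t by (intro mult_right_mono) (auto simp: w_def)
  qed auto
  finally show ?case
    using U x xU by (intro exI[of _ "insert x U"]) (auto simp: mult_ac inj_on_insert)
qed


section \<open>Zones and their normals\<close>

text \<open>Parametrized by a normal of any length, so that normals can be drawn from a ball; the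
  value at \<open>u = 0\<close> is a junk case that is excluded later.\<close>

definition zone :: "real \<Rightarrow> 'a::euclidean_space \<Rightarrow> 'a set" where
  "zone t u = {x \<in> sphere 0 1. (INF y\<in>sphere 0 1 \<inter> {x. u \<bullet> x = 0}. spherical_dist x y) \<le> t}"

lemma spherical_zone_zone: "u \<noteq> 0 \<Longrightarrow> spherical_zone t (zone t u)"
  unfolding spherical_zone_def great_sphere_def zone_def by blast

lemma abs_inner_unit_le: "norm x = 1 \<Longrightarrow> norm y = 1 \<Longrightarrow> \<bar>x \<bullet> y\<bar> \<le> 1"
  using Cauchy_Schwarz_ineq2[of x y] by simp

lemma zoneI:
  assumes "norm x = 1" "norm y = 1" "u \<bullet> y = 0" "spherical_dist x y \<le> t"
  shows "x \<in> zone t u"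
proof -
  have "bdd_below ((\<lambda>y. spherical_dist x y) ` (sphere 0 1 \<inter> {x. u \<bullet> x = 0}))"
    using assms(1) abs_inner_unit_le[of x]
    by (intro bdd_belowI2[of _ 0]) (auto simp: spherical_dist_def abs_le_iff intro!: arccos_lbound)
  then show ?thesis
    using assms by (auto simp: zone_def intro: cINF_lower2)
qed

text \<open>By compactness a nearest point \<open>y\<close> of the great sphere exists, with
  \<open>x \<bullet> y\<close> at least \<open>cos t\<close>. Bessel's inequality for the
  orthonormal pair \<open>y\<close>, \<open>sgn u\<close> leaves at most \<open>sin t\<close> for
  the component along \<open>u\<close>.\<close>

lemma abs_inner_zone_le:
  fixes u :: "'a::euclidean_space"
  assumes x: "x \<in> zone t u" and t: "0 \<le> t" "t \<le> pi / 2" and dim: "2 \<le> DIM('a)"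
  shows "\<bar>u \<bullet> x\<bar> \<le> sin t * norm u"
proof (cases "u = 0")
  case False
  let ?G = "sphere 0 1 \<inter> {x. u \<bullet> x = 0}"
  have nx: "norm x = 1"
    using x by (simp add: zone_def)
  obtain z where "z \<noteq> 0" "orthogonal u z"
    using orthogonal_to_vector_exists[OF dim] by blast
  then have "sgn z \<in> ?G"
    by (simp add: norm_sgn sgn_div_norm orthogonal_def)
  then have ne: "?G \<noteq> {}"
    by blast
  have "compact ?G"
    by (intro compact_Int_closed compact_sphere closed_hyperplane)
  moreover have "continuous_on ?G (spherical_dist x)"
    unfolding spherical_dist_def using abs_inner_unit_le[OF nx]
    by (intro continuous_intros) (auto simp: abs_le_iff)
  ultimately obtain y where y: "y \<in> ?G" and min: "\<And>z. z \<in> ?G \<Longrightarrow> spherical_dist x y \<le> spherical_dist x z"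
    using continuous_attains_inf[OF _ ne] by blast
  have "spherical_dist x y \<le> (INF y\<in>?G. spherical_dist x y)"
    by (rule cINF_greatest[OF ne min])
  then have "arccos (x \<bullet> y) \<le> t"
    using x by (simp add: zone_def spherical_dist_def)
  moreover have xy: "-1 \<le> x \<bullet> y" "x \<bullet> y \<le> 1"
    using abs_inner_unit_le[OF nx, of y] y by auto
  ultimately have "cos t \<le> cos (arccos (x \<bullet> y))"
    using t by (intro cos_monotone_0_pi_le arccos_lbound) auto
  then have "cos t \<le> x \<bullet> y"
    using xy by simp
  moreover have "0 \<le> cos t"
    using t by (intro cos_ge_zero) auto
  ultimately have cos: "(cos t)\<^sup>2 \<le> (x \<bullet> y)\<^sup>2"
    by (intro power_mono)
  define v where "v = sgn u"
  have v: "v \<bullet> v = 1" "y \<bullet> v = 0" and nv: "y \<bullet> y = 1" "x \<bullet> x = 1"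
    using False y nx by (auto simp: v_def sgn_div_norm dot_square_norm inner_commute power2_eq_square norm_eq_1)
  have "0 \<le> (x - (x \<bullet> y) *\<^sub>R y - (x \<bullet> v) *\<^sub>R v) \<bullet> (x - (x \<bullet> y) *\<^sub>R y - (x \<bullet> v) *\<^sub>R v)"
    by simp
  also have "\<dots> = 1 - (x \<bullet> y)\<^sup>2 - (x \<bullet> v)\<^sup>2"
    using v nv by (simp add: inner_diff_left inner_diff_right inner_commute power2_eq_square)
  finally have "(x \<bullet> v)\<^sup>2 \<le> (sin t)\<^sup>2"
    using cos by (simp add: sin_squared_eq)
  then have "\<bar>x \<bullet> v\<bar> \<le> sin t"
    using t sin_ge_zero[of t] by (simp add: abs_le_square_iff[symmetric])
  then show ?thesis
    using False by (simp add: v_def sgn_div_norm field_simps inner_commute abs_mult)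
qed simp

text \<open>An arrangement is a set, so different normals must yield different zones. For
  nonparallel normals, a boundary point of one zone, tilted towards the pole of the other, violates
  the slab bound of the other; this uses \<open>sin t < cos t\<close>, hence the bound
  \<open>pi / 4\<close>.\<close>

lemma zone_eq_imp_parallel:
  fixes u v :: "'a::euclidean_space"
  assumes eq: "zone t u = zone t v" and t: "0 < t" "t < pi / 4" and dim: "2 \<le> DIM('a)"
    and u: "u \<noteq> 0" and v: "v \<noteq> 0"
  shows "v \<in> span {u}"
proof (rule ccontr)
  assume notin: "v \<notin> span {u}"
  \<comment> \<open>The sign turns the poles \<open>a\<close> and \<open>b\<close> to a nonnegative
    inner product \<open>c\<close>.\<close>
  define \<sigma> :: real where "\<sigma> = (if u \<bullet> v \<ge> 0 then 1 else -1)"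
  define a where "a = \<sigma> *\<^sub>R sgn u"
  define b where "b = sgn v"
  define c where "c = a \<bullet> b"
  define w where "w = b - c *\<^sub>R a"
  have aa: "a \<bullet> a = 1" and bb: "b \<bullet> b = 1"
    using u v by (auto simp: a_def b_def \<sigma>_def sgn_div_norm dot_square_norm power2_eq_square)
  have c0: "0 \<le> c"
    by (simp add: c_def a_def b_def \<sigma>_def sgn_div_norm mult_le_0_iff)
  have "w \<noteq> 0"
  proof
    assume "w = 0"
    then have "norm v *\<^sub>R b = norm v *\<^sub>R (c *\<^sub>R a)"
      by (simp add: w_def)
    then have "v = norm v *\<^sub>R (c *\<^sub>R a)"
      using v by (simp add: b_def sgn_div_norm)
    moreover have "a \<in> span {u}"
      by (simp add: a_def sgn_div_norm span_base span_scale)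
    ultimately show False
      using notin by (metis span_scale)
  qed
  moreover have ww: "w \<bullet> w = (1 - c) * (1 + c)"
    using aa bb by (simp add: w_def inner_diff_left inner_diff_right inner_commute c_def[symmetric] algebra_simps)
  ultimately have c1: "c < 1"
    using c0 by (metis inner_gt_zero_iff add_nonneg_pos diff_gt_0_iff_gt zero_less_mult_pos2 zero_less_one add.commute)
  \<comment> \<open>From \<open>1 - c \<le> 1 + c\<close>; it bounds the norm of \<open>w\<close>
    below linearly in \<open>1 - c\<close>, the quantity cancelled at the end.\<close>
  have "(1 - c) * (1 - c) \<le> w \<bullet> w"
    unfolding ww using c0 c1 by (intro mult_left_mono) auto
  then have "(1 - c)\<^sup>2 \<le> (norm w)\<^sup>2"
    by (simp only: power2_norm_eq_inner power2_eq_square[of "1 - c"])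
  then have nw: "1 - c \<le> norm w"
    by (rule power2_le_imp_le) simp
  have aw: "a \<bullet> w = 0" and bw: "b \<bullet> w = (norm w)\<^sup>2"
    using aa bb ww unfolding power2_norm_eq_inner ww
    by (simp_all add: w_def inner_diff_right c_def inner_commute algebra_simps)
  define y where "y = sgn w"
  \<comment> \<open>On the boundary of \<open>zone t u\<close>, nearest to the pole \<open>b\<close> of \<open>zone t v\<close>.\<close>
  define x where "x = sin t *\<^sub>R a + cos t *\<^sub>R y"
  have yy: "y \<bullet> y = 1" and ay: "a \<bullet> y = 0" and b_y: "b \<bullet> y = norm w"
    using \<open>w \<noteq> 0\<close> aw bw by (auto simp: y_def sgn_div_norm dot_square_norm power2_eq_square)
  have "x \<bullet> x = (sin t)\<^sup>2 + (cos t)\<^sup>2"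
    using aa yy ay by (simp add: x_def inner_add_left inner_add_right inner_commute power2_eq_square)
  then have "norm x = 1"
    by (simp add: norm_eq_1)
  moreover have "norm y = 1"
    using yy by (simp add: norm_eq_1)
  moreover have "u \<bullet> y = 0"
    using ay u by (auto simp: a_def \<sigma>_def sgn_div_norm split: if_splits)
  moreover have "x \<bullet> y = cos t"
    using ay yy by (simp add: x_def inner_add_left)
  ultimately have "x \<in> zone t u"
    using t by (intro zoneI[of _ y]) (auto simp: spherical_dist_def arccos_cos)
  then have "\<bar>v \<bullet> x\<bar> \<le> sin t * norm v"
    unfolding eq using t dim by (intro abs_inner_zone_le) auto
  then have "b \<bullet> x \<le> sin t"
    using v by (simp add: b_def sgn_div_norm field_simps abs_le_iff)
  moreover have "b \<bullet> x = c * sin t + cos t * norm w"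
    using b_y by (simp add: x_def inner_add_right c_def inner_commute)
  moreover have "cos t * (1 - c) \<le> cos t * norm w"
    using nw t by (intro mult_left_mono cos_ge_zero) auto
  ultimately have "(1 - c) * cos t \<le> (1 - c) * sin t"
    by (simp add: algebra_simps)
  then have "cos t \<le> sin t"
    using c1 by simp
  moreover have "sin t < cos t"
  proof -
    have "sin t < sin (pi / 2 - t)"
      using t by (intro sin_monotone_2pi) auto
    then show ?thesis
      by (simp add: cos_sin_eq)
  qed
  ultimately show False
    by simp
qed

section \<open>Chernoff and union bound for fixed n\<close>

text \<open>Splitting off \<open>y ^ k\<close>, it suffices that
  \<open>c * \<rho> ^ (k + 1) * y \<le> 1\<close>. For large \<open>k\<close> the power of
  \<open>\<rho>\<close> beats \<open>c\<close>; for small \<open>k\<close> the extra factor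
  \<open>y\<close> does. Thus \<open>\<epsilon>\<close> is uniform in \<open>k\<close>.\<close>

lemma chernoff_threshold:
  fixes c :: real
  assumes c: "1 \<le> c" and e: "1 \<le> e" and \<rho>: "0 \<le> \<rho>" "\<rho> < 1"
  obtains \<epsilon> where "0 < \<epsilon>"
    "\<And>a y k. \<lbrakk>0 < a; a < \<epsilon>; 0 \<le> y; 1 \<le> k; y ^ k < a ^ e\<rbrakk> \<Longrightarrow> c * (\<rho> * y) ^ (k + 1) < a ^ e"
proof -
  obtain K where K: "c * \<rho> ^ K < 1"
  proof -
    have "(\<lambda>K. c * \<rho> ^ K) \<longlonglongrightarrow> c * 0"
      using \<rho> by (intro tendsto_intros LIMSEQ_realpow_zero) auto
    then have "\<forall>\<^sub>F K in sequentially. c * \<rho> ^ K < 1"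
      by (rule order_tendstoD) simp
    then show ?thesis
      using that by (auto simp: eventually_sequentially)
  qed
  \<comment> \<open>Chosen so that \<open>y ^ k < \<epsilon>\<close> forces
    \<open>y \<le> 1 / c\<close> for every \<open>k\<close> below \<open>K\<close>.\<close>
  define \<epsilon> where "\<epsilon> = (1 / c) ^ K"
  have \<epsilon>: "0 < \<epsilon>" "\<epsilon> \<le> 1"
    using c by (auto simp: \<epsilon>_def power_le_one)
  have "c * (\<rho> * y) ^ (k + 1) < a ^ e"
    if a: "0 < a" "a < \<epsilon>" and y: "0 \<le> y" and "1 \<le> k" and yk: "y ^ k < a ^ e" for a y k
  proof -
    have "a ^ e \<le> a ^ 1"
      using a \<epsilon> e by (intro power_decreasing) auto
    then have ae: "a ^ e < \<epsilon>"
      using a by simp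
    have "c * \<rho> ^ (k + 1) * y \<le> 1"
    proof (cases "K \<le> k")
      case True
      have "y \<le> 1"
      proof (rule ccontr)
        assume "\<not> y \<le> 1"
        then have "1 \<le> y ^ k"
          by (simp add: one_le_power)
        then show False
          using yk ae \<epsilon> by simp
      qed
      moreover have "c * \<rho> ^ (k + 1) \<le> c * \<rho> ^ K"
        using c \<rho> True by (intro mult_left_mono power_decreasing) auto
      ultimately show ?thesis
        using K y by (intro mult_le_one[of "c * \<rho> ^ (k + 1)"]) linarith+
    next
      case False
      have "y \<le> 1 / c"
      proof (rule ccontr)
        assume "\<not> y \<le> 1 / c"
        then have "(1 / c) ^ k \<le> y ^ k"
          using c by (intro power_mono) auto
        moreover have "\<epsilon> \<le> (1 / c) ^ k"
          unfolding \<epsilon>_def using False c by (intro power_decreasing) auto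
        ultimately show False
          using yk ae by simp
      qed
      then have "c * y \<le> 1"
        using c by (simp add: field_simps)
      moreover have "\<rho> ^ (k + 1) \<le> 1"
        using \<rho> by (intro power_le_one) auto
      ultimately have "(c * y) * \<rho> ^ (k + 1) \<le> 1"
        using \<rho> by (intro mult_le_one[of "c * y"]) auto
      then show ?thesis
        by (simp add: mult_ac)
    qed
    then have "c * \<rho> ^ (k + 1) * y * y ^ k \<le> 1 * y ^ k"
      using y by (intro mult_right_mono) auto
    then show ?thesis
      using yk by (simp add: power_mult_distrib mult_ac)
  qed
  with \<epsilon> show ?thesis
    using that by blast
qed

text \<open>\<open>p\<close> bounds the chance that a random normal falls in the slab of a net
  point, and \<open>small\<close> says that the union bound over the net succeeds.\<close>

lemma low_multiplicity_zones:
  fixes a m :: real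
  assumes d: "CARD('d::finite) = d" "2 \<le> d" and a: "0 < a" "a \<le> 1" and m: "0 < m" "m * a < pi / 4"
    and n: "1 \<le> n"
    and p_def: "p = 2 * ((m + 1) * a) * unit_ball_vol (real d - 1) / unit_ball_vol (real d)"
    and small: "real d * 4 ^ d * (exp 1 * (real n * p) / real (k + 1)) ^ (k + 1) < a ^ (d - 1)"
  shows "\<exists>\<Z> :: (real ^ 'd) set set. finite \<Z> \<and> card \<Z> = n \<and> (\<forall>Z\<in>\<Z>. spherical_zone (m * a) Z) \<and>
    (\<forall>x\<in>sphere 0 1. card {Z \<in> \<Z>. x \<in> Z} \<le> k)"
proof -
  define t where "t = m * a"
  \<comment> \<open>Half-width \<open>m * a\<close> of the zones plus the net radius
    \<open>a\<close>.\<close>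
  define s where "s = (m + 1) * a"
  have t: "0 < t" "t < pi / 4" and s: "0 < s"
    using a m by (auto simp: t_def s_def)
  have dim: "2 \<le> DIM(real ^ 'd)"
    using d by simp
  obtain Q :: "(real ^ 'd) set" where Q: "finite Q" "Q \<subseteq> sphere 0 1"
    and net: "\<And>x. x \<in> sphere 0 1 \<Longrightarrow> \<exists>q\<in>Q. dist x q \<le> a"
    and cardQ: "real (card Q) * a ^ (d - 1) \<le> real d * 4 ^ d"
    using sphere_net[OF a, where ?'a = "real ^ 'd"] d by auto
  define M where "M = uniform_measure lborel (ball (0 :: real ^ 'd) 1)"
  have ball: "measure lborel (ball (0 :: real ^ 'd) 1) = unit_ball_vol (real d)"
    "emeasure lborel (ball (0 :: real ^ 'd) 1) = ennreal (unit_ball_vol (real d))"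
    using d by (simp_all add: content_ball emeasure_ball)
  have \<kappa>: "0 < unit_ball_vol (real d)" "0 < unit_ball_vol (real d - 1)"
    using d by auto
  have ball_pos: "emeasure lborel (ball (0 :: real ^ 'd) 1) \<noteq> 0"
    unfolding ball ennreal_eq_0_iff not_le by (rule \<kappa>)
  interpret prob_space M
    unfolding M_def using ball_pos by (intro prob_space_uniform_measure) (auto simp: ball)
  define A where "A q = {x :: real ^ 'd. \<bar>q \<bullet> x\<bar> < s}" for q
  have A: "A q \<in> sets borel" for q
    unfolding A_def by (intro borel_open open_Collect_less continuous_intros)
  have prob_A: "prob (A q) \<le> p" if "q \<in> Q" for q
  proof -
    have "emeasure lborel (ball 0 1 \<inter> A q) \<le> ennreal (2 * s * unit_ball_vol (real d - 1))"
      unfolding A_def using emeasure_slab_le[of q s] that Q s d by auto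
    then have "measure lborel (ball 0 1 \<inter> A q) \<le> 2 * s * unit_ball_vol (real d - 1)"
      using s \<kappa> by (auto simp: measure_def intro!: enn2real_leI)
    then show ?thesis
      unfolding M_def p_def s_def using A ball_pos
      by (subst measure_uniform_measure) (auto simp: ball divide_right_mono)
  qed
  \<comment> \<open>Used with \<open>u = 0\<close> to exclude the zero normal, and with a given
    normal to exclude all its multiples.\<close>
  have off_line: "AE x in lborel. x \<notin> span {u}" for u :: "real ^ 'd"
  proof (rule AE_not_in)
    have "dim (span {u}) < DIM(real ^ 'd)"
      using dim_le_card'[of "{u}"] dim by simp
    then have "span {u} \<in> null_sets lebesgue"
      using negligible_lowdim negligible_iff_null_sets by blast
    then show "span {u} \<in> null_sets lborel"
      by (simp add: null_sets_completion_iff closed_subspace)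
  qed
  have AE_G: "AE x in M. x \<noteq> 0 \<and> norm x < 1"
    unfolding M_def
  proof (rule AE_uniform_measureI)
    show "AE x in lborel. x \<in> ball (0 :: real ^ 'd) 1 \<longrightarrow> x \<noteq> 0 \<and> norm x < 1"
      using off_line[of 0] by eventually_elim auto
  qed simp
  have AE_zone: "AE x in M. zone t x \<noteq> c" for c :: "(real ^ 'd) set"
    unfolding M_def
  proof (rule AE_uniform_measureI)
    \<comment> \<open>One normal represents \<open>c\<close>, and any other lies on its line; if
      \<open>c\<close> is no zone, any \<open>u\<close> will do.\<close>
    obtain u :: "real ^ 'd" where u: "\<And>x. x \<noteq> 0 \<Longrightarrow> zone t x = c \<Longrightarrow> zone t u = c \<and> u \<noteq> 0"
      by (cases "\<exists>x. x \<noteq> 0 \<and> zone t x = c") blast+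
    show "AE x in lborel. x \<in> ball 0 1 \<longrightarrow> zone t x \<noteq> c"
      using off_line[of u]
    proof eventually_elim
      case (elim x)
      then have "x \<noteq> 0"
        using span_0 by blast
      then show ?case
        using elim u zone_eq_imp_parallel[of t u x] t dim by metis
    qed
  qed simp
  have p: "0 < p"
    using a m \<kappa> by (simp add: p_def)
  \<comment> \<open>The minimizer of \<open>exp (n * p * (\<tau> - 1)) / \<tau> ^ (k + 1)\<close>,
    the optimal Chernoff base.\<close>
  define \<tau> where "\<tau> = real (k + 1) / (real n * p)"
  have \<tau>: "0 < \<tau>"
    using p n by (simp add: \<tau>_def)
  have z: "exp 1 * (real n * p) / real (k + 1) = exp 1 / \<tau>"
    by (simp add: \<tau>_def)
  \<comment> \<open>Since also \<open>1 \<le> real d * 4 ^ d\<close>, the hypothesis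
    \<open>small\<close> itself forces \<open>\<tau>\<close> above \<open>exp 1\<close>, hence above
    1.\<close>
  have "a ^ (d - 1) \<le> 1"
    using a by (simp add: power_le_one)
  moreover have "1 * (exp 1 / \<tau>) ^ (k + 1) \<le> real d * 4 ^ d * (exp 1 / \<tau>) ^ (k + 1)"
  proof (rule mult_right_mono)
    have "1 * 1 \<le> real d * 4 ^ d"
      using d(2) by (intro mult_mono) auto
    then show "1 \<le> real d * 4 ^ d"
      by simp
    show "0 \<le> (exp 1 / \<tau>) ^ (k + 1)"
      using \<tau> by (intro zero_le_power divide_nonneg_pos exp_ge_zero)
  qed
  ultimately have zk: "(exp 1 / \<tau>) ^ (k + 1) < 1"
    using small unfolding z by linarith
  have "exp 1 < \<tau>"
  proof (rule ccontr)
    assume "\<not> exp 1 < \<tau>"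
    then have "1 \<le> (exp 1 / \<tau>) ^ (k + 1)"
      using \<tau> by (intro one_le_power) simp
    then show False
      using zk by simp
  qed
  then have \<tau>1: "1 < \<tau>"
    using exp_ge_add_one_self[of 1] by simp
  have ev: "A q \<in> events" for q
    using A by (simp add: M_def)
  have "\<exists>U. finite U \<and> card U = n \<and> inj_on (zone t) U \<and> (\<forall>u\<in>U. u \<noteq> 0 \<and> norm u < 1) \<and>
      (\<Sum>q\<in>Q. \<tau> ^ card (U \<inter> A q)) \<le> real (card Q) * (1 + p * (\<tau> - 1)) ^ n"
    by (rule low_multiplicity_selection[OF Q(1) ev prob_A less_imp_le[OF \<tau>1] AE_G AE_zone])
  then obtain U where U: "finite U" "card U = n" "inj_on (zone t) U" "\<forall>u\<in>U. u \<noteq> 0 \<and> norm u < 1"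
    and pot: "(\<Sum>q\<in>Q. \<tau> ^ card (U \<inter> A q)) \<le> real (card Q) * (1 + p * (\<tau> - 1)) ^ n"
    by (elim exE conjE) (rule that)
  have "(1 + p * (\<tau> - 1)) ^ n \<le> exp (p * (\<tau> - 1)) ^ n"
    using p \<tau>1 by (intro power_mono exp_ge_add_one_self) auto
  also have "\<dots> = exp (real (k + 1) - real n * p)"
    using p n by (simp add: exp_of_nat_mult[symmetric] \<tau>_def field_simps)
  also have "\<dots> \<le> exp (real (k + 1) * 1)"
    using p by simp
  also have "\<dots> = exp 1 ^ (k + 1)"
    by (rule exp_of_nat_mult)
  finally have e: "(1 + p * (\<tau> - 1)) ^ n \<le> exp 1 ^ (k + 1)" .
  \<comment> \<open>The net bound and \<open>small\<close> share the factor
    \<open>a ^ (d - 1)\<close>, which cancels.\<close>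
  have "a ^ (d - 1) * (real (card Q) * (exp 1 / \<tau>) ^ (k + 1)) \<le> real d * 4 ^ d * (exp 1 / \<tau>) ^ (k + 1)"
    using mult_right_mono[OF cardQ, of "(exp 1 / \<tau>) ^ (k + 1)"] \<tau> by (simp add: mult_ac)
  also have "\<dots> < a ^ (d - 1) * 1"
    using small unfolding z by simp
  finally have "real (card Q) * (exp 1 / \<tau>) ^ (k + 1) < 1"
    using a by (simp only: mult_less_cancel_left_pos zero_less_power)
  then have "real (card Q) * exp 1 ^ (k + 1) < \<tau> ^ (k + 1)"
    using \<tau> by (simp add: power_divide field_simps)
  then have pot': "(\<Sum>q\<in>Q. \<tau> ^ card (U \<inter> A q)) < \<tau> ^ (k + 1)"
    using pot mult_left_mono[OF e, of "real (card Q)"] by simp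
  \<comment> \<open>A single summand is below \<open>\<tau> ^ (k + 1)\<close>, so its exponent is at
    most \<open>k\<close>.\<close>
  have few: "card (U \<inter> A q) \<le> k" if "q \<in> Q" for q
  proof -
    have "\<tau> ^ card (U \<inter> A q) \<le> (\<Sum>q\<in>Q. \<tau> ^ card (U \<inter> A q))"
      using Q(1) that \<tau> by (intro member_le_sum) auto
    then have "\<tau> ^ card (U \<inter> A q) < \<tau> ^ (k + 1)"
      using pot' by simp
    then show ?thesis
      using \<tau>1 by (simp only: power_strict_increasing_iff)
  qed
  have "card {Z \<in> zone t ` U. x \<in> Z} \<le> k" if x: "x \<in> sphere 0 1" for x
  proof -
    obtain q where q: "q \<in> Q" "dist x q \<le> a"
      using net[OF x] by blast
    \<comment> \<open>Moving from \<open>x\<close> to the net point \<open>q\<close> costs at most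
      \<open>norm u * a\<close>; the strict bound comes from \<open>norm u < 1\<close>.\<close>
    have "u \<in> A q" if u: "u \<in> U" and xu: "x \<in> zone t u" for u
    proof -
      have "u \<bullet> q = u \<bullet> x + u \<bullet> (q - x)"
        by (simp add: inner_diff_right)
      then have "\<bar>q \<bullet> u\<bar> \<le> \<bar>u \<bullet> x\<bar> + \<bar>u \<bullet> (q - x)\<bar>"
        by (simp add: inner_commute)
      also have "\<dots> \<le> sin t * norm u + norm u * a"
      proof (intro add_mono)
        show "\<bar>u \<bullet> x\<bar> \<le> sin t * norm u"
          using xu t dim by (intro abs_inner_zone_le) auto
        have "\<bar>u \<bullet> (q - x)\<bar> \<le> norm u * norm (q - x)"
          by (rule Cauchy_Schwarz_ineq2)
        also have "\<dots> \<le> norm u * a"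
          using q(2) by (intro mult_left_mono) (auto simp: dist_norm norm_minus_commute)
        finally show "\<bar>u \<bullet> (q - x)\<bar> \<le> norm u * a" .
      qed
      also have "\<dots> \<le> norm u * s"
        using sin_x_le_x[of t] t mult_left_mono[of "sin t" t "norm u"] by (simp add: s_def t_def algebra_simps)
      also have "\<dots> < 1 * s"
        using U(4) u s by (intro mult_strict_right_mono) auto
      finally show ?thesis
        by (simp add: A_def)
    qed
    then have "{Z \<in> zone t ` U. x \<in> Z} \<subseteq> zone t ` (U \<inter> A q)"
      by blast
    then have "card {Z \<in> zone t ` U. x \<in> Z} \<le> card (zone t ` (U \<inter> A q))"
      using U(1) by (intro card_mono) auto
    also have "\<dots> \<le> card (U \<inter> A q)"
      using U(1) by (intro card_image_le) auto
    also have "\<dots> \<le> k"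
      using few q(1) by blast
    finally show ?thesis .
  qed
  moreover have "spherical_zone (m * a) Z" if "Z \<in> zone t ` U" for Z
    using that U(4) spherical_zone_zone unfolding t_def by blast
  ultimately show ?thesis
    using U(1,2) card_image[OF U(3)] by (intro exI[of _ "zone t ` U"]) auto
qed

section \<open>From the limsup condition to all large n\<close>

theorem theorem2:
  fixes d :: nat and \<alpha> :: "nat \<Rightarrow> real" and k :: "nat \<Rightarrow> nat" and \<beta> :: real
  assumes "CARD('d::finite) = d" and "d \<ge> 3"
    and "\<And>n. n \<ge> 1 \<Longrightarrow> 0 < \<alpha> n \<and> \<alpha> n \<le> 1"
    and "\<alpha> \<longlonglongrightarrow> 0"
    and "\<And>n. n \<ge> 1 \<Longrightarrow> k n \<ge> 1"
    and "limsup (\<lambda>n. ereal (\<alpha> n powi (- (int d - 1)) *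
           (exp 1 * C_star d * real n * \<alpha> n / real (k n)) ^ k n)) = ereal \<beta>"
    and "\<beta> < 1"
  shows "\<forall>\<^sub>F n in sequentially.
           \<exists>\<Z> :: (real ^ 'd) set set.
             finite \<Z> \<and> card \<Z> = n \<and>
             (\<forall>Z\<in>\<Z>. spherical_zone (m_const d * \<alpha> n) Z) \<and>
             (\<forall>p\<in>sphere 0 1. card {Z \<in> \<Z>. p \<in> Z} \<le> k n)"
proof -
  define m where "m = m_const d"
  define c where "c = real d * 4 ^ d"
  define K0 where "K0 = unit_ball_vol (real d)"
  define K1 where "K1 = unit_ball_vol (real d - 1)"
  have m: "0 < m"
    by (simp add: m_def m_const_def add_nonneg_pos)
  have K: "0 < K0" "0 < K1"
    using \<open>d \<ge> 3\<close> by (auto simp: K0_def K1_def)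
  have "1 * 1 \<le> c"
    unfolding c_def using \<open>d \<ge> 3\<close> by (intro mult_mono) auto
  then have "1 \<le> c"
    by simp
  then obtain \<epsilon> where \<epsilon>: "0 < \<epsilon>" and thr: "\<And>a y k. \<lbrakk>0 < a; a < \<epsilon>; 0 \<le> y; 1 \<le> k; y ^ k < a ^ (d - 1)\<rbrakk>
      \<Longrightarrow> c * (3 / 4 * y) ^ (k + 1) < a ^ (d - 1)"
  proof (rule chernoff_threshold)
    show "1 \<le> d - 1" "0 \<le> (3 / 4 :: real)" "3 / 4 < (1 :: real)"
      using \<open>d \<ge> 3\<close> by auto
  qed blast
  have "\<forall>\<^sub>F n in sequentially. ereal (\<alpha> n powi (- (int d - 1)) *
           (exp 1 * C_star d * real n * \<alpha> n / real (k n)) ^ k n) < 1"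
    using assms(6,7) by (intro Limsup_lessD) simp
  \<comment> \<open>\<open>\<epsilon>\<close> serves the threshold lemma; \<open>pi / 4 / m\<close>
    keeps the half-width below \<open>pi / 4\<close>, where zones determine their normals up to
    scaling.\<close>
  moreover have "\<forall>\<^sub>F n in sequentially. \<alpha> n < min \<epsilon> (pi / 4 / m)"
    using assms(4) by (rule order_tendstoD) (use \<epsilon> m in auto)
  ultimately show ?thesis
    using eventually_ge_at_top[of 1]
  proof eventually_elim
    case (elim n)
    define a where "a = \<alpha> n"
    define y where "y = exp 1 * C_star d * real n * a / real (k n)"
    define p where "p = 2 * ((m + 1) * a) * K1 / K0"
    have a: "0 < a" "a \<le> 1" "a < \<epsilon>" "m * a < pi / 4" and k: "1 \<le> k n"
      using assms(3,5)[of n] elim m by (auto simp: a_def field_simps)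
    have "- (int d - 1) = - int (d - 1)"
      using \<open>d \<ge> 3\<close> by simp
    then have "a powi (- (int d - 1)) = inverse (a ^ (d - 1))"
      by (simp only: power_int_minus power_int_of_nat)
    then have "y ^ k n / a ^ (d - 1) < 1"
      using elim(1) unfolding y_def a_def[symmetric] by (simp add: field_simps)
    then have yk: "y ^ k n < a ^ (d - 1)"
      using a(1) by simp
    have C: "C_star d = 4 * (m + 1) * (real d - 1) * K1 / (real d * K0)"
      by (simp add: C_star_def m_def K0_def K1_def)
    have y0: "0 \<le> y"
      unfolding y_def C using m a K \<open>d \<ge> 3\<close> by auto
    have p0: "0 \<le> p"
      unfolding p_def using m a K by simp
    \<comment> \<open>The quotient of \<open>p\<close> by \<open>C_star d * a\<close> is
      \<open>d / (2 * (d - 1))\<close>, at most \<open>3 / 4\<close> exactly from dimension 3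
      on.\<close>
    have "p \<le> 3 / 4 * (C_star d * a)"
    proof -
      have "3 / 4 * (C_star d * a) = p * (3 * (real d - 1) / (2 * real d))"
        unfolding C p_def using K \<open>d \<ge> 3\<close> by (simp add: field_simps)
      moreover have "1 \<le> 3 * (real d - 1) / (2 * real d)"
        using \<open>d \<ge> 3\<close> by (simp add: field_simps)
      ultimately show ?thesis
        using p0 mult_left_mono[of 1 "3 * (real d - 1) / (2 * real d)" p] by linarith
    qed
    moreover from this have "0 \<le> C_star d * a"
      using p0 by linarith
    \<comment> \<open>The denominator drops to \<open>k n\<close> to match \<open>y\<close>, while
      the exponent stays \<open>k n + 1\<close>, as \<open>thr\<close> requires.\<close>
    ultimately have "exp 1 * (real n * p) / real (k n + 1) \<le> exp 1 * (real n * (3 / 4 * (C_star d * a))) / real (k n)"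
      using k by (intro frac_le mult_left_mono) auto
    also have "\<dots> = 3 / 4 * y"
      by (simp add: y_def)
    finally have "(exp 1 * (real n * p) / real (k n + 1)) ^ (k n + 1) \<le> (3 / 4 * y) ^ (k n + 1)"
      using p0 by (intro power_mono) auto
    then have "c * (exp 1 * (real n * p) / real (k n + 1)) ^ (k n + 1) \<le> c * (3 / 4 * y) ^ (k n + 1)"
      using \<open>1 \<le> c\<close> by (intro mult_left_mono) auto
    also have "\<dots> < a ^ (d - 1)"
      using thr a y0 k yk by blast
    finally show ?case
      using low_multiplicity_zones[OF assms(1) _ a(1,2) m a(4) elim(3) p_def[unfolded K0_def K1_def], of "k n"] \<open>d \<ge> 3\<close>
      unfolding c_def a_def m_def by auto
  qed
qed

end
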